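(* Let $X$ be a path-connected space, $x_0\in X$, and $H\leq\pi_1(X,x_0)$ a subgroup. Then $X$ has transfinite path products relative to $H$ if and only if $H$ is $(W,w_\infty)$-closed.
   Context: A map is a continuous function; $f_{\#}$ denotes the homomorphism induced on fundamental groups. For paths, $\alpha\cdot\beta$ is concatenation and $\alpha^{-}$ the reverse path; restrictions of paths to subintervals are regarded as paths via linear reparametrization. $X$ has transfinite path products relative to $H$ if for every closed set $A\subseteq[0,1]$ containing $\{0,1\}$ and all paths $p,q:([0,1],0)\to(X,x_0)$ such that $p|_A=q|_A$ and $[p|_{[0,b]}\cdot q|_{[a,b]}^{-}\cdot p|_{[0,a]}^{-}]\in H$ for every component $(a,b)$ of $[0,1]\setminus A$, we have $[p\cdot q^{-}]\in H$. Closed subgroups: for a based space $(\mathbb{T},t_0)$, a subgroup $T\leq\pi_1(\mathbb{T},t_0)$ and $g\in\pi_1(\mathbb{T},t_0)$, a subgroup $H\leq\pi_1(X,x_0)$ is $(T,g)$-closed if for every map $f:(\mathbb{T},t_0)\to(X,x_0)$ with $f_{\#}(T)\leq H$ we have $f_{\#}(g)\in H$. The test space $\mathbb{W}$: let $\mathcal{C}\subseteq[0,1]$ be the standard middle third Cantor set and $\mathcal{I}$ the set of components of $[0,1]\setminus\mathcal{C}$. For $I=(a,b)\in\mathcal{I}$ let $\mathbb{W}_I\subseteq\mathbb{R}^2$ be the upper half ($y\geq0$) of the circle with diameter $[a,b]\times\{0\}$. Let $\mathbb{W}=([0,1]\times\{0\})\cup\bigcup_{I\in\mathcal{I}}\mathbb{W}_I\subseteq\mathbb{R}^2$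 with basepoint $d_0=(0,0)$. Let $\lambda_\infty:[0,1]\to\mathbb{W}$, $\lambda_\infty(t)=(t,0)$, and let $\upsilon_\infty:[0,1]\to\mathbb{W}$ be the arc with $\upsilon_\infty(t)=(t,0)$ for $t\in\mathcal{C}$ and, for $I=(a,b)\in\mathcal{I}$, $\upsilon_\infty|_{[a,b]}$ the arc along $\mathbb{W}_I$ from $(a,0)$ to $(b,0)$. $W\leq\pi_1(\mathbb{W},d_0)$ is the subgroup generated by $\{[\upsilon_\infty|_{[0,b]}\cdot\lambda_\infty|_{[a,b]}^{-}\cdot\upsilon_\infty|_{[0,a]}^{-}]\mid(a,b)\in\mathcal{I}\}$, and $w_\infty=[\upsilon_\infty\cdot\lambda_\infty^{-}]$. *)

theory Defs
  imports "HOL-Analysis.Analysis" "HOL-Algebra.Generated_Groups"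
begin

section \<open>The fundamental group\<close>

text \<open>
  A space is a subset \<open>S\<close> (with the subspace topology) of a type of class
  \<^class>\<open>topological_space\<close>. A path class \<open>[p]\<close> is a set of functions on \<^typ>\<open>real\<close>; as usual in
  HOL-Analysis only the values on \<open>{0..1}\<close> matter.
\<close>

definition path_class :: "'a::topological_space set \<Rightarrow> (real \<Rightarrow> 'a) \<Rightarrow> (real \<Rightarrow> 'a) set" where
  "path_class S p = {q. homotopic_paths S p q}"

definition based_path :: "'a::topological_space set \<Rightarrow> 'a \<Rightarrow> (real \<Rightarrow> 'a) \<Rightarrow> bool" where
  "based_path S x p \<longleftrightarrow> path p \<and> path_image p \<subseteq> S \<and> pathstart p = x"

definition loop_at :: "'a::topological_space set \<Rightarrow> 'a \<Rightarrow> (real \<Rightarrow> 'a) \<Rightarrow> bool" where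
  "loop_at S x p \<longleftrightarrow> based_path S x p \<and> pathfinish p = x"

definition fundamental_group ::
    "'a::topological_space set \<Rightarrow> 'a \<Rightarrow> (real \<Rightarrow> 'a) set monoid" where
  "fundamental_group S x =
     \<lparr> carrier = path_class S ` Collect (loop_at S x),
       monoid.mult = (\<lambda>c d. {r. \<exists>p\<in>c. \<exists>q\<in>d. homotopic_paths S (p +++ q) r}),
       one = path_class S (\<lambda>_. x) \<rparr>"

text \<open>The map \<open>f\<^sub>#\<close> induced on path classes by a map \<open>f\<close> into the space \<open>S\<close>.\<close>

definition induced_map ::
    "'a::topological_space set \<Rightarrow> ('b::topological_space \<Rightarrow> 'a) \<Rightarrow> (real \<Rightarrow> 'b) set \<Rightarrow> (real \<Rightarrow> 'a) set" where
  "induced_map S f c = {r. \<exists>p\<in>c. homotopic_paths S (f \<circ> p) r}"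

text \<open>
  The restriction of a path to \<open>{a..b}\<close>, linearly reparametrized; the library's \<^const>\<open>subpath\<close> is
  the same function but is confined to normed vector spaces.
\<close>

definition path_restrict :: "(real \<Rightarrow> 'a) \<Rightarrow> real \<Rightarrow> real \<Rightarrow> real \<Rightarrow> 'a" where
  "path_restrict p a b = (\<lambda>t. p (a + (b - a) * t))"


section \<open>Transfinite path products and closed subgroups\<close>

text \<open>The class of \<open>p|[0,b] \<sqdot> (q|[a,b])\<^sup>- \<sqdot> (p|[0,a])\<^sup>-\<close>.\<close>

definition gap_class ::
    "'a::topological_space set \<Rightarrow> (real \<Rightarrow> 'a) \<Rightarrow> (real \<Rightarrow> 'a) \<Rightarrow> real \<Rightarrow> real \<Rightarrow> (real \<Rightarrow> 'a) set" where
  "gap_class S p q a b =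
     path_class S ((path_restrict p 0 b +++ reversepath (path_restrict q a b))
                   +++ reversepath (path_restrict p 0 a))"

text \<open>
  Since \<open>0\<close> and \<open>1\<close> belong to the closed set \<open>A\<close>, every component of \<open>{0..1} - A\<close> has the form
  \<open>{a<..<b}\<close> with \<open>a < b\<close>.
\<close>

definition transfinite_path_products ::
    "'a::topological_space set \<Rightarrow> 'a \<Rightarrow> (real \<Rightarrow> 'a) set set \<Rightarrow> bool" where
  "transfinite_path_products S x H \<longleftrightarrow>
     (\<forall>A p q. closed A \<and> A \<subseteq> {0..1} \<and> {0, 1} \<subseteq> A \<and>
        based_path S x p \<and> based_path S x q \<and>
        (\<forall>t\<in>A. p t = q t) \<and>
        (\<forall>a b. {a<..<b} \<in> components ({0..1} - A) \<longrightarrow> gap_class S p q a b \<in> H)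
      \<longrightarrow> path_class S (p +++ reversepath q) \<in> H)"

definition closed_subgroup ::
    "'b::topological_space set \<Rightarrow> 'b \<Rightarrow> (real \<Rightarrow> 'b) set set \<Rightarrow> (real \<Rightarrow> 'b) set \<Rightarrow>
     'a::topological_space set \<Rightarrow> 'a \<Rightarrow> (real \<Rightarrow> 'a) set set \<Rightarrow> bool" where
  "closed_subgroup Y y T g S x H \<longleftrightarrow>
     (\<forall>f. continuous_on Y f \<and> f ` Y \<subseteq> S \<and> f y = x \<and> induced_map S f ` T \<subseteq> H
        \<longrightarrow> induced_map S f g \<in> H)"


section \<open>The test space\<close>

primrec cantor_stage :: "nat \<Rightarrow> real set" where
  "cantor_stage 0 = {0..1}"
| "cantor_stage (Suc n) = (\<lambda>x. x / 3) ` cantor_stage n \<union> (\<lambda>x. (x + 2) / 3) ` cantor_stage n"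

definition cantor_set :: "real set" where
  "cantor_set = (\<Inter>n. cantor_stage n)"

definition cantor_gap :: "real \<Rightarrow> real \<Rightarrow> bool" where
  "cantor_gap a b \<longleftrightarrow> {a<..<b} \<in> components ({0..1} - cantor_set)"

definition half_circle :: "real \<Rightarrow> real \<Rightarrow> (real \<times> real) set" where
  "half_circle a b = {z. dist z ((a + b) / 2, 0) = (b - a) / 2 \<and> snd z \<ge> 0}"

definition W_space :: "(real \<times> real) set" where
  "W_space = {0..1} \<times> {0} \<union> (\<Union>{half_circle a b | a b. cantor_gap a b})"

definition lower_path :: "real \<Rightarrow> real \<times> real" where
  "lower_path t = (t, 0)"

text \<open>
  The arc through the half circles, parametrized by the first coordinate: for \<open>t\<close> in a gap,
  \<open>upper_path t\<close> is the unique point of the half circle over that gap lying above \<open>t\<close>.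
\<close>

definition upper_path :: "real \<Rightarrow> real \<times> real" where
  "upper_path t =
     (if t \<in> cantor_set then (t, 0)
      else (t, THE y. \<exists>a b. cantor_gap a b \<and> t \<in> {a<..<b} \<and> (t, y) \<in> half_circle a b))"

definition W_subgroup :: "(real \<Rightarrow> real \<times> real) set set" where
  "W_subgroup = generate (fundamental_group W_space (0, 0))
     {gap_class W_space upper_path lower_path a b | a b. cantor_gap a b}"

definition w_infinity :: "(real \<Rightarrow> real \<times> real) set" where
  "w_infinity = path_class W_space (upper_path +++ reversepath lower_path)"


section \<open>Basic facts\<close>

lemma path_class_eqI: "homotopic_paths S p q \<Longrightarrow> path_class S p = path_class S q"
  unfolding path_class_def by (blast intro: homotopic_paths_sym homotopic_paths_trans)

lemma homotopic_const_join:
  assumes "path p" "path_image p \<subseteq> S" "pathstart p = x"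
  shows "homotopic_paths S ((\<lambda>_. x) +++ p) p"
proof -
  have "homotopic_paths S p ((\<lambda>_. x) +++ p)"
  proof (rule homotopic_paths_reparametrize[OF assms(1,2), where f = "\<lambda>t. max 0 (2 * t - 1)"])
    show "((\<lambda>_. x) +++ p) t = p (max 0 (2 * t - 1))" if "t \<in> {0..1}" for t
    proof (cases "t \<le> 1 / 2")
      case True
      then show ?thesis using assms(3) by (simp add: joinpaths_def pathstart_def)
    next
      case False
      then show ?thesis by (simp add: joinpaths_def)
    qed
  qed (auto intro!: continuous_intros)
  then show ?thesis by (rule homotopic_paths_sym)
qed

lemma homotopic_join_reversepath:
  assumes "path p" "path_image p \<subseteq> S" "pathstart p = x"
  shows "homotopic_paths S (p +++ reversepath p) (\<lambda>_. x)"
proof -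
  let ?u = "\<lambda>z::real \<times> real. (1 - fst z) * (1 - \<bar>2 * snd z - 1\<bar>)"
  have u: "?u z \<in> {0..1}" if "z \<in> {0..1} \<times> {0..1}" for z
    using that by (auto intro!: mult_nonneg_nonneg mult_le_one)
  have p: "continuous_on {0..1} p" using assms(1) by (simp add: path_def)
  have "continuous_on ({0..1} \<times> {0..1}) (\<lambda>z. p (?u z))"
    by (rule continuous_on_compose2[OF p]) (use u in \<open>auto intro!: continuous_intros\<close>)
  moreover have "(\<lambda>z. p (?u z)) \<in> {0..1} \<times> {0..1} \<rightarrow> S"
    using u assms(2) by (fastforce simp: path_image_def)
  moreover have "p (?u (0, t)) = (p +++ reversepath p) t" if "t \<in> {0..1}" for t
    using that by (auto simp: joinpaths_def reversepath_def abs_if algebra_simps)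
  ultimately show ?thesis
    unfolding homotopic_paths using assms(3)
    by (intro exI[of _ "\<lambda>z. p (?u z)"])
       (auto simp: pathstart_def pathfinish_def joinpaths_def reversepath_def)
qed

lemma loop_at_join: "loop_at S x p \<Longrightarrow> loop_at S x q \<Longrightarrow> loop_at S x (p +++ q)"
  by (simp add: loop_at_def based_path_def path_image_join)

lemma loop_at_reversepath: "loop_at S x p \<Longrightarrow> loop_at S x (reversepath p)"
  by (simp add: loop_at_def based_path_def)

lemma loop_at_const: "x \<in> S \<Longrightarrow> loop_at S x (\<lambda>_. x)"
  by (auto simp: loop_at_def based_path_def path_def path_image_def pathstart_def pathfinish_def)

lemma fundamental_group_mult:
  assumes "loop_at S x p" "loop_at S x q"
  shows "path_class S p \<otimes>\<^bsub>fundamental_group S x\<^esub> path_class S q = path_class S (p +++ q)"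
proof -
  have refl: "homotopic_paths S p p" "homotopic_paths S q q"
    using assms by (simp_all add: loop_at_def based_path_def)
  have join: "homotopic_paths S (p +++ q) (p' +++ q')"
    if "homotopic_paths S p p'" "homotopic_paths S q q'" for p' q'
    using that assms by (intro homotopic_paths_join) (auto simp: loop_at_def based_path_def)
  have "(\<exists>p'\<in>path_class S p. \<exists>q'\<in>path_class S q. homotopic_paths S (p' +++ q') r) \<longleftrightarrow>
      homotopic_paths S (p +++ q) r" for r
    unfolding path_class_def mem_Collect_eq Bex_def
    using refl join homotopic_paths_trans by blast
  then show ?thesis
    by (simp add: fundamental_group_def path_class_def[of S "p +++ q"])
qed

theorem group_fundamental_group:
  assumes "x \<in> S"
  shows "group (fundamental_group S x)"
proof (rule groupI)
  let ?G = "fundamental_group S x"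
  have carrier: "c \<in> carrier ?G \<longleftrightarrow> (\<exists>p. loop_at S x p \<and> c = path_class S p)" for c
    by (auto simp: fundamental_group_def)
  have one: "\<one>\<^bsub>?G\<^esub> = path_class S (\<lambda>_. x)"
    by (simp add: fundamental_group_def)
  show "\<one>\<^bsub>?G\<^esub> \<in> carrier ?G"
    using loop_at_const[OF assms] by (auto simp: carrier one)
  show "c \<otimes>\<^bsub>?G\<^esub> d \<in> carrier ?G" if cd: "c \<in> carrier ?G" "d \<in> carrier ?G" for c d
  proof -
    obtain p q where "loop_at S x p" "c = path_class S p" "loop_at S x q" "d = path_class S q"
      using cd unfolding carrier by blast
    then show ?thesis
      unfolding carrier by (metis fundamental_group_mult loop_at_join)
  qed
  show "c \<otimes>\<^bsub>?G\<^esub> d \<otimes>\<^bsub>?G\<^esub> e = c \<otimes>\<^bsub>?G\<^esub> (d \<otimes>\<^bsub>?G\<^esub> e)"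
    if cde: "c \<in> carrier ?G" "d \<in> carrier ?G" "e \<in> carrier ?G" for c d e
  proof -
    obtain p q r where p: "loop_at S x p" "c = path_class S p"
        and q: "loop_at S x q" "d = path_class S q" and r: "loop_at S x r" "e = path_class S r"
      using cde unfolding carrier by blast
    have "homotopic_paths S (p +++ (q +++ r)) ((p +++ q) +++ r)"
      using p q r by (intro homotopic_paths_assoc) (auto simp: loop_at_def based_path_def)
    then have "path_class S (p +++ (q +++ r)) = path_class S ((p +++ q) +++ r)"
      by (rule path_class_eqI)
    then show ?thesis
      using p q r by (simp add: fundamental_group_mult loop_at_join)
  qed
  show "\<one>\<^bsub>?G\<^esub> \<otimes>\<^bsub>?G\<^esub> c = c" if c: "c \<in> carrier ?G" for c
  proof -
    obtain p where p: "loop_at S x p" "c = path_class S p"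
      using c unfolding carrier by blast
    have "homotopic_paths S ((\<lambda>_. x) +++ p) p"
      using p by (intro homotopic_const_join) (auto simp: loop_at_def based_path_def)
    then show ?thesis
      using p by (simp add: one fundamental_group_mult loop_at_const[OF assms] path_class_eqI)
  qed
  show "\<exists>d\<in>carrier ?G. d \<otimes>\<^bsub>?G\<^esub> c = \<one>\<^bsub>?G\<^esub>" if c: "c \<in> carrier ?G" for c
  proof -
    obtain p where p: "loop_at S x p" "c = path_class S p"
      using c unfolding carrier by blast
    have "homotopic_paths S (reversepath p +++ reversepath (reversepath p)) (\<lambda>_. x)"
      using p by (intro homotopic_join_reversepath) (auto simp: loop_at_def based_path_def)
    then have "path_class S (reversepath p) \<otimes>\<^bsub>?G\<^esub> c = \<one>\<^bsub>?G\<^esub>"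
      using p by (simp add: one fundamental_group_mult loop_at_reversepath path_class_eqI)
    moreover have "path_class S (reversepath p) \<in> carrier ?G"
      using p loop_at_reversepath unfolding carrier by blast
    ultimately show ?thesis by blast
  qed
qed

lemma complement_component_exists:
  fixes A :: "real set"
  assumes A: "closed A" "A \<subseteq> {0..1}" "{0, 1} \<subseteq> A" and t: "t \<in> {0..1} - A"
  obtains a b where "{a<..<b} \<in> components ({0..1} - A)" "t \<in> {a<..<b}" "a \<in> A" "b \<in> A"
proof -
  define a where "a = Sup (A \<inter> {..t})"
  define b where "b = Inf (A \<inter> {t..})"
  have ne: "A \<inter> {..t} \<noteq> {}" "A \<inter> {t..} \<noteq> {}" using A(3) t by auto
  have bdd: "bdd_above (A \<inter> {..t})" "bdd_below (A \<inter> {t..})" by auto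
  have a: "a \<in> A" "a \<le> t"
    using closed_contains_Sup[OF ne(1) bdd(1)] A(1) by (auto simp: a_def closed_Int)
  have b: "b \<in> A" "t \<le> b"
    using closed_contains_Inf[OF ne(2) bdd(2)] A(1) by (auto simp: b_def closed_Int)
  have lt: "a < t" "t < b" using a b t by (auto simp: order.strict_iff_order)
  have out: "s \<notin> A" if "s \<in> {a<..<b}" for s
  proof
    assume s: "s \<in> A"
    show False
    proof (cases "s \<le> t")
      case True
      then have "s \<le> a" unfolding a_def using s by (intro cSup_upper bdd) auto
      then show False using that by simp
    next
      case False
      then have "b \<le> s" unfolding b_def using s by (intro cInf_lower bdd) auto
      then show False using that by simp
    qed
  qed
  have sub: "{a<..<b} \<subseteq> {0..1} - A"
    using out a b A(2) by (fastforce simp: subset_iff)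
  have "d = {a<..<b}" if d: "{a<..<b} \<subseteq> d" "d \<subseteq> {0..1} - A" "connected d" for d
  proof -
    have "t \<in> d" using d(1) lt by auto
    have "a < s \<and> s < b" if s: "s \<in> d" for s
    proof (rule ccontr)
      assume "\<not> (a < s \<and> s < b)"
      then have "a \<in> d \<or> b \<in> d"
        using connectedD_interval[OF d(3) s \<open>t \<in> d\<close>, of a]
          connectedD_interval[OF d(3) \<open>t \<in> d\<close> s, of b] lt by fastforce
      then show False using d(2) a b by auto
    qed
    then show ?thesis using d(1) by auto
  qed
  then have "{a<..<b} \<in> components ({0..1} - A)"
    unfolding in_components_maximal using sub lt by auto
  then show thesis using that lt a b by auto
qed

lemma complement_component_endpoints:
  fixes A :: "real set"
  assumes A: "closed A" "A \<subseteq> {0..1}" "{0, 1} \<subseteq> A" and ab: "{a<..<b} \<in> components ({0..1} - A)"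
  shows "a < b" "a \<in> A" "b \<in> A"
proof -
  have "{a<..<b} \<noteq> {}" using ab in_components_nonempty by blast
  then obtain t where t: "t \<in> {a<..<b}" by blast
  then show "a < b" by simp
  have "t \<in> {0..1} - A" using ab t in_components_subset by blast
  then obtain c d where cd: "{c<..<d} \<in> components ({0..1} - A)" "t \<in> {c<..<d}" "c \<in> A" "d \<in> A"
    using complement_component_exists[OF A] by blast
  then have "{a<..<b} = {c<..<d}"
    using components_eq[OF ab cd(1)] t by blast
  then have "a = c" "b = d"
    using t cd(2) by (auto simp: greaterThanLessThan_eq_iff)
  then show "a \<in> A" "b \<in> A" using cd by auto
qed

lemma closed_cantor_set: "closed cantor_set"
proof -
  have "compact (cantor_stage n)" for n
    by (induction n) (auto intro!: compact_Un compact_continuous_image continuous_intros)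
  then show ?thesis unfolding cantor_set_def by (auto intro: compact_imp_closed)
qed

lemma cantor_set_subset: "cantor_set \<subseteq> {0..1}"
  unfolding cantor_set_def by (rule INF_lower2[of 0]) auto

lemma cantor_set_endpoints: "{0, 1} \<subseteq> cantor_set"
proof -
  have "0 \<in> cantor_stage n \<and> 1 \<in> cantor_stage n" for n
    by (induction n) (auto simp: image_iff)
  then show ?thesis by (simp add: cantor_set_def)
qed

lemmas cantor_facts = closed_cantor_set cantor_set_subset cantor_set_endpoints

lemma cantor_gap_unique:
  assumes "cantor_gap a b" "cantor_gap c d" "t \<in> {a<..<b}" "t \<in> {c<..<d}"
  shows "a = c \<and> b = d"
proof -
  have "{a<..<b} = {c<..<d}"
    using assms components_eq unfolding cantor_gap_def by blast
  then show ?thesis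
    using assms(3,4) by (auto simp: greaterThanLessThan_eq_iff)
qed

lemma cantor_gapD:
  assumes "cantor_gap a b"
  shows "a < b" "a \<in> cantor_set" "b \<in> cantor_set" "0 \<le> a" "b \<le> 1"
    "\<And>t. t \<in> {a<..<b} \<Longrightarrow> t \<notin> cantor_set"
proof -
  note C = complement_component_endpoints[OF cantor_facts assms[unfolded cantor_gap_def]]
  then show "a < b" "a \<in> cantor_set" "b \<in> cantor_set" by auto
  then show "0 \<le> a" "b \<le> 1" using cantor_set_subset by auto
  show "t \<notin> cantor_set" if "t \<in> {a<..<b}" for t
    using in_components_subset[OF assms[unfolded cantor_gap_def]] that by blast
qed

lemma half_circle_iff:
  assumes "a < b"
  shows "(t, y) \<in> half_circle a b \<longleftrightarrow> t \<in> {a..b} \<and> y = sqrt ((t - a) * (b - t))"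
proof -
  let ?c = "(a + b) / 2" and ?r = "(b - a) / 2"
  have "dist (t, y) (?c, 0) = ?r \<longleftrightarrow> sqrt ((t - ?c)\<^sup>2 + y\<^sup>2) = sqrt (?r\<^sup>2)"
    using assms by (simp add: dist_Pair_Pair dist_real_def)
  also have "\<dots> \<longleftrightarrow> (t - ?c)\<^sup>2 + y\<^sup>2 = ?r\<^sup>2"
    by (rule real_sqrt_eq_iff)
  also have "\<dots> \<longleftrightarrow> y\<^sup>2 = (t - a) * (b - t)"
    by (auto simp: field_simps power2_eq_square)
  finally have d: "dist (t, y) (?c, 0) = ?r \<longleftrightarrow> y\<^sup>2 = (t - a) * (b - t)" .
  have "0 \<le> (t - a) * (b - t) \<longleftrightarrow> t \<in> {a..b}"
    using assms by (auto simp: zero_le_mult_iff)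
  moreover have "y\<^sup>2 = k \<and> 0 \<le> y \<longleftrightarrow> 0 \<le> k \<and> y = sqrt k" for k
    by auto
  ultimately show ?thesis
    unfolding half_circle_def mem_Collect_eq snd_conv d by blast
qed

lemma upper_path_cantor: "t \<in> cantor_set \<Longrightarrow> upper_path t = (t, 0)"
  by (simp add: upper_path_def)

lemma upper_path_gap:
  assumes ab: "cantor_gap a b" and t: "t \<in> {a..b}"
  shows "upper_path t = (t, sqrt ((t - a) * (b - t)))"
proof (cases "t \<in> {a<..<b}")
  case True
  have "(THE y. \<exists>a b. cantor_gap a b \<and> t \<in> {a<..<b} \<and> (t, y) \<in> half_circle a b) =
      sqrt ((t - a) * (b - t))"
  proof (rule the_equality)
    show "\<exists>a' b'. cantor_gap a' b' \<and> t \<in> {a'<..<b'} \<and>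
        (t, sqrt ((t - a) * (b - t))) \<in> half_circle a' b'"
      using ab t True cantor_gapD(1)[OF ab] half_circle_iff by blast
    show "y = sqrt ((t - a) * (b - t))"
      if "\<exists>a b. cantor_gap a b \<and> t \<in> {a<..<b} \<and> (t, y) \<in> half_circle a b" for y
      using that cantor_gap_unique[OF ab _ True] half_circle_iff cantor_gapD(1) by blast
  qed
  then show ?thesis using cantor_gapD(6)[OF ab True] by (simp add: upper_path_def)
next
  case False
  then have "t = a \<or> t = b" using t by auto
  then show ?thesis using cantor_gapD[OF ab] by (auto simp: upper_path_cantor)
qed

lemma unit_interval_cases:
  assumes "t \<in> {0..1}"
  obtains "t \<in> cantor_set" | a b where "cantor_gap a b" "t \<in> {a<..<b}"
  using complement_component_exists[OF cantor_facts, of t] assms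
  unfolding cantor_gap_def by blast

lemma path_image_upper_path: "path_image upper_path \<subseteq> W_space"
proof -
  have "upper_path t \<in> W_space" if "t \<in> {0..1}" for t
    using that
  proof (cases rule: unit_interval_cases)
    case 1
    then show ?thesis using that by (simp add: upper_path_cantor W_space_def)
  next
    case (2 a b)
    then have "upper_path t \<in> half_circle a b"
      using half_circle_iff[OF cantor_gapD(1)] by (auto simp: upper_path_gap)
    then show ?thesis unfolding W_space_def using 2 by blast
  qed
  then show ?thesis by (auto simp: path_image_def)
qed

lemma path_upper_path: "path upper_path"
proof -
  define k where "k t = (snd (upper_path t))\<^sup>2" for t
  have k_gap: "k t = (t - a) * (b - t)" if "cantor_gap a b" "t \<in> {a..b}" for a b t
    using that by (simp add: k_def upper_path_gap)
  have k_nonneg: "0 \<le> k t" for t by (simp add: k_def)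
  have k_le: "k t \<le> \<bar>t - c\<bar>" if "t \<in> {0..1}" and c: "c \<in> cantor_set" for t c
    using that(1)
  proof (cases rule: unit_interval_cases)
    case 1
    then show ?thesis by (simp add: k_def upper_path_cantor)
  next
    case (2 a b)
    note D = cantor_gapD[OF 2(1)]
    have "c \<le> a \<or> b \<le> c" using D(6)[of c] c by force
    moreover have "(t - a) * (b - t) \<le> t - a" "(t - a) * (b - t) \<le> b - t"
      using 2(2) D by (auto intro!: mult_left_le mult_left_le_one_le)
    moreover have "k t = (t - a) * (b - t)"
      using 2 by (intro k_gap) auto
    ultimately show ?thesis by linarith
  qed
  have lip: "\<bar>k s - k t\<bar> \<le> t - s" if st: "s \<in> {0..1}" "t \<in> {0..1}" "s \<le> t" for s t
  proof (cases "\<exists>c\<in>cantor_set. s \<le> c \<and> c \<le> t")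
    case True
    then obtain c where "c \<in> cantor_set" "s \<le> c" "c \<le> t" by blast
    then show ?thesis using k_le[OF st(1), of c] k_le[OF st(2), of c] k_nonneg[of s] k_nonneg[of t]
      by linarith
  next
    case False
    then have "s \<notin> cantor_set" using st by auto
    with st(1) obtain a b where ab: "cantor_gap a b" "s \<in> {a<..<b}"
      by (meson unit_interval_cases)
    note D = cantor_gapD[OF ab(1)]
    have tb: "t < b" using False D(3) ab(2) by force
    have "\<bar>(s - t) * (a + b - s - t)\<bar> \<le> \<bar>s - t\<bar> * 1"
      unfolding abs_mult using ab(2) tb st D by (intro mult_left_mono) auto
    moreover have "k s - k t = (s - t) * (a + b - s - t)"
      using k_gap[OF ab(1), of s] k_gap[OF ab(1), of t] ab(2) tb st by (auto simp: algebra_simps)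
    ultimately show ?thesis using st by simp
  qed
  have "\<bar>k s - k t\<bar> \<le> \<bar>s - t\<bar>" if "s \<in> {0..1}" "t \<in> {0..1}" for s t
    using lip[of s t] lip[of t s] that by (cases "s \<le> t") auto
  then have "1-lipschitz_on {0..1} k"
    by (intro lipschitz_onI) (simp_all add: dist_real_def)
  then have "continuous_on {0..1} k"
    by (rule lipschitz_on_continuous_on)
  then have "continuous_on {0..1} (\<lambda>t. (t, sqrt (k t)))" by (intro continuous_intros)
  moreover have "upper_path t = (t, sqrt (k t))" if "t \<in> {0..1}" for t
    using that
  proof (cases rule: unit_interval_cases)
    case 1
    then show ?thesis by (simp add: k_def upper_path_cantor)
  next
    case (2 a b)
    then show ?thesis using k_gap[OF 2(1), of t] upper_path_gap[OF 2(1), of t] by auto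
  qed
  ultimately show ?thesis
    unfolding path_def using continuous_on_eq[of "{0..1}" "\<lambda>t. (t, sqrt (k t))" upper_path] by simp
qed

lemma based_path_upper_path: "based_path W_space (0, 0) upper_path"
  using path_upper_path path_image_upper_path upper_path_cantor[of 0] cantor_set_endpoints
  by (auto simp: based_path_def pathstart_def)

lemma based_path_lower_path: "based_path W_space (0, 0) lower_path"
  unfolding based_path_def path_def path_image_def pathstart_def lower_path_def W_space_def
  by (auto intro!: continuous_intros)

lemma path_restrict_path:
  assumes "based_path S x p" "0 \<le> a" "a \<le> b" "b \<le> 1"
  shows "path (path_restrict p a b)" "path_image (path_restrict p a b) \<subseteq> S"
    "pathstart (path_restrict p a b) = p a" "pathfinish (path_restrict p a b) = p b"
proof -
  have "a + (b - a) * t \<in> {0..1}" if "t \<in> {0..1}" for t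
    using that assms(2-4) mult_left_le[of t "b - a"] by auto
  then have m: "(\<lambda>t. a + (b - a) * t) ` {0..1} \<subseteq> {0..1}" by blast
  have p: "continuous_on {0..1} p" "p ` {0..1} \<subseteq> S"
    using assms(1) by (auto simp: based_path_def path_def path_image_def)
  show "path (path_restrict p a b)"
    unfolding path_def path_restrict_def
    by (rule continuous_on_compose2[OF p(1) _ m]) (intro continuous_intros)
  show "path_image (path_restrict p a b) \<subseteq> S"
    using m p(2) by (fastforce simp: path_image_def path_restrict_def)
qed (simp_all add: path_restrict_def pathstart_def pathfinish_def)

lemma gap_class_in_carrier:
  assumes "based_path S x p" "based_path S x q" "0 \<le> a" "a \<le> b" "b \<le> 1" "p a = q a" "p b = q b"
  shows "gap_class S p q a b \<in> carrier (fundamental_group S x)"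
proof -
  have "p 0 = x" using assms(1) by (simp add: based_path_def pathstart_def)
  then have "loop_at S x ((path_restrict p 0 b +++ reversepath (path_restrict q a b))
                   +++ reversepath (path_restrict p 0 a))"
    using assms path_restrict_path[OF assms(1), of 0 a] path_restrict_path[OF assms(1), of 0 b]
      path_restrict_path[OF assms(2), of a b]
    by (simp add: loop_at_def based_path_def path_image_join)
  then show ?thesis by (simp add: gap_class_def fundamental_group_def)
qed

lemma subgroup_W_subgroup: "subgroup W_subgroup (fundamental_group W_space (0, 0))"
proof -
  have "gap_class W_space upper_path lower_path a b \<in> carrier (fundamental_group W_space (0, 0))"
    if "cantor_gap a b" for a b
    using cantor_gapD[OF that]
    by (intro gap_class_in_carrier based_path_upper_path based_path_lower_path)
       (auto simp: upper_path_cantor lower_path_def)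
  moreover have "(0, 0) \<in> W_space" by (simp add: W_space_def)
  ultimately show ?thesis
    unfolding W_subgroup_def by (intro group.generate_is_subgroup group_fundamental_group) auto
qed

lemma w_infinity_in_carrier: "w_infinity \<in> carrier (fundamental_group W_space (0, 0))"
proof -
  have "pathfinish upper_path = pathfinish lower_path"
    using cantor_set_endpoints by (simp add: pathfinish_def upper_path_cantor lower_path_def)
  then have "loop_at W_space (0, 0) (upper_path +++ reversepath lower_path)"
    using based_path_upper_path based_path_lower_path
    by (simp add: loop_at_def based_path_def path_image_join)
  then show ?thesis by (simp add: w_infinity_def fundamental_group_def)
qed

end

theory Submission
  imports Defs
begin

text \<open>
  A map \<open>f\<close> on the test space is the same thing as a pair of paths, \<open>f \<circ> upper_path\<close> and
  \<open>f \<circ> lower_path\<close>, that agree on the Cantor set. Under this correspondence the generators of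
  \<^const>\<open>W_subgroup\<close> go to the gap classes of the two paths over the Cantor gaps and
  \<^const>\<open>w_infinity\<close> goes to the class of the first path followed by the reverse of the second
  (\<open>induced_map_gap_class\<close>, \<open>induced_map_w_infinity\<close>). Hence closedness of \<open>H\<close> is exactly the
  transfinite product property for the one closed set \<^const>\<open>cantor_set\<close>, and one direction of
  the equivalence is immediate.

  For the other direction an arbitrary closed set \<open>A\<close> with \<open>{0, 1} \<subseteq> A \<subseteq> {0..1}\<close> has to be reduced
  to the Cantor set. The reduction is a continuous \<open>g\<close> from the unit interval to itself that fixes
  \<open>0\<close> and \<open>1\<close>, maps the Cantor set into \<open>A\<close>, and sends the two endpoints of every Cantor gap
  either to one point or to the two endpoints of a component of the complement of \<open>A\<close>
  (\<open>cantor_parametrization\<close>). It is obtained by bisection: an interval with endpoints in \<open>A\<close> is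
  cut at its midpoint if that lies in \<open>A\<close>, and otherwise along the component around the midpoint,
  and the middle third is spent on the piece cut out. Each remaining piece has at most half the
  length, so the construction converges uniformly.

  If \<open>p\<close> and \<open>q\<close> agree on \<open>A\<close>, then \<open>p \<circ> g\<close> and \<open>q \<circ> g\<close> agree on the Cantor set. Since the unit
  interval is convex, reparametrizing by \<open>g\<close> does not change path classes
  (\<open>homotopic_path_restrict_reparametrize\<close>). So each gap class of the new pair is
  trivial or a gap class of the old pair, and the two pairs have the same total class.
\<close>

section \<open>Path classes under maps and reparametrizations\<close>

lemma induced_map_path_class:
  assumes f: "continuous_on Y f" "f ` Y \<subseteq> S" and p: "path p" "path_image p \<subseteq> Y"
  shows "induced_map S f (path_class Y p) = path_class S (f \<circ> p)"
proof -
  have "homotopic_paths S (f \<circ> p) (f \<circ> p')" if "homotopic_paths Y p p'" for p'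
    using homotopic_paths_continuous_image[OF that f(1)] f(2) by auto
  moreover have "homotopic_paths Y p p" using p by simp
  ultimately show ?thesis
    unfolding induced_map_def path_class_def
    by (blast intro: homotopic_paths_trans)
qed

lemma loop_at_compose:
  assumes "continuous_on Y f" "f ` Y \<subseteq> S" "f y = x" "loop_at Y y p"
  shows "loop_at S x (f \<circ> p)"
  using assms unfolding loop_at_def based_path_def
  by (auto simp: path_image_compose pathstart_compose pathfinish_compose
      intro!: path_continuous_image intro: continuous_on_subset)

lemma induced_map_hom:
  assumes f: "continuous_on Y f" "f ` Y \<subseteq> S" "f y = x"
  shows "induced_map S f \<in> hom (fundamental_group Y y) (fundamental_group S x)"
proof (rule homI)
  have map: "induced_map S f (path_class Y p) = path_class S (f \<circ> p)" if "loop_at Y y p" for p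
    using that by (intro induced_map_path_class f) (auto simp: loop_at_def based_path_def)
  have carrier: "c \<in> carrier (fundamental_group Y y) \<longleftrightarrow>
      (\<exists>p. loop_at Y y p \<and> c = path_class Y p)" for c
    by (auto simp: fundamental_group_def)
  show "induced_map S f c \<in> carrier (fundamental_group S x)"
    if c: "c \<in> carrier (fundamental_group Y y)" for c
  proof -
    obtain p where "loop_at Y y p" "c = path_class Y p"
      using c unfolding carrier by blast
    then show ?thesis
      using loop_at_compose[OF f] map by (auto simp: fundamental_group_def)
  qed
  show "induced_map S f (c \<otimes>\<^bsub>fundamental_group Y y\<^esub> d) =
      induced_map S f c \<otimes>\<^bsub>fundamental_group S x\<^esub> induced_map S f d"
    if cd: "c \<in> carrier (fundamental_group Y y)" "d \<in> carrier (fundamental_group Y y)" for c d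
  proof -
    obtain p q where "loop_at Y y p" "c = path_class Y p" "loop_at Y y q" "d = path_class Y q"
      using cd unfolding carrier by blast
    then show ?thesis
      by (simp add: fundamental_group_mult map loop_at_join loop_at_compose[OF f]
          path_compose_join)
  qed
qed

lemma induced_map_generate_subset:
  assumes f: "continuous_on Y f" "f ` Y \<subseteq> S" "f y = x" and y: "y \<in> Y"
    and H: "subgroup H (fundamental_group S x)"
    and K: "K \<subseteq> carrier (fundamental_group Y y)" "induced_map S f ` K \<subseteq> H"
  shows "induced_map S f ` generate (fundamental_group Y y) K \<subseteq> H"
proof -
  have "x \<in> S" using f y by auto
  then interpret group_hom "fundamental_group Y y" "fundamental_group S x" "induced_map S f"
    using group_fundamental_group[OF y] group_fundamental_group[of x S] induced_map_hom[OF f]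
    by (simp add: group_hom_def group_hom_axioms_def)
  show ?thesis
    using generate_img[OF K(1)] H.generate_subgroup_incl[OF K(2) H] by simp
qed

lemma induced_map_gap_class:
  assumes f: "continuous_on Y f" "f ` Y \<subseteq> S"
    and p: "based_path Y y p" and q: "based_path Y y q"
    and ab: "0 \<le> a" "a \<le> b" "b \<le> 1" and eq: "p a = q a" "p b = q b"
  shows "induced_map S f (gap_class Y p q a b) = gap_class S (f \<circ> p) (f \<circ> q) a b"
proof -
  let ?r = "(path_restrict p 0 b +++ reversepath (path_restrict q a b)) +++
      reversepath (path_restrict p 0 a)"
  have r: "path ?r" "path_image ?r \<subseteq> Y"
    using path_restrict_path[OF p, of 0 a] path_restrict_path[OF p, of 0 b]
      path_restrict_path[OF q, of a b] ab eq
    by (simp_all add: path_image_join)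
  have restrict: "f \<circ> path_restrict u c d = path_restrict (f \<circ> u) c d" for u c d
    by (simp add: path_restrict_def o_def)
  show ?thesis
    unfolding gap_class_def induced_map_path_class[OF f r]
    by (simp add: path_compose_join path_compose_reversepath restrict)
qed

lemma induced_map_w_infinity:
  assumes "continuous_on W_space f" "f ` W_space \<subseteq> S"
  shows "induced_map S f w_infinity =
    path_class S ((f \<circ> upper_path) +++ reversepath (f \<circ> lower_path))"
proof -
  have "pathfinish upper_path = pathfinish lower_path"
    using cantor_set_endpoints by (simp add: pathfinish_def upper_path_cantor lower_path_def)
  then show ?thesis
    unfolding w_infinity_def using based_path_upper_path based_path_lower_path
    by (subst induced_map_path_class[OF assms])
       (auto simp: based_path_def path_image_join path_compose_join path_compose_reversepath)
qed

text \<open>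
  Inside the convex unit interval the straight-line homotopy deforms \<open>g\<close> on \<open>{a..b}\<close>, relative to
  the endpoints, to the affine map with the same values there.
\<close>

lemma homotopic_path_restrict_reparametrize:
  assumes p: "path p" "path_image p \<subseteq> S"
    and g: "continuous_on {0..1} g" "g ` {0..1} \<subseteq> {0..1}"
    and ab: "0 \<le> a" "a \<le> b" "b \<le> 1"
    and p': "\<And>t. t \<in> {0..1} \<Longrightarrow> p' t = p (g t)"
  shows "homotopic_paths S (path_restrict p (g a) (g b)) (path_restrict p' a b)"
proof -
  let ?h = "path_restrict g a b" and ?k = "path_restrict (\<lambda>t. t) (g a) (g b)"
  have "based_path {0..1} (g 0) g"
    using g by (auto simp: based_path_def path_def path_image_def pathstart_def)
  note h = path_restrict_path[OF this ab]
  have gab: "g a \<in> {0..1}" "g b \<in> {0..1}" using g(2) ab by (simp_all add: image_subset_iff)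
  have k_image: "?k t \<in> {0..1}" if "t \<in> {0..1}" for t
  proof -
    have "?k t = (1 - t) *\<^sub>R g a + t *\<^sub>R g b"
      by (simp add: path_restrict_def algebra_simps)
    then show ?thesis
      using convexD_alt[of "{0..1}" "g a" "g b" t] that gab by simp
  qed
  have "homotopic_paths {0..1} ?k ?h"
  proof (rule homotopic_paths_linear)
    show "path ?k" by (auto simp: path_def path_restrict_def intro!: continuous_intros)
    show "closed_segment (?k t) (?h t) \<subseteq> {0..1}" if "t \<in> {0..1}" for t
      using that k_image[OF that] h(2)
      by (intro closed_segment_subset) (simp_all add: path_image_def image_subset_iff)
  qed (use h in \<open>simp_all add: pathstart_def pathfinish_def path_restrict_def\<close>)
  then have "homotopic_paths S (p \<circ> ?k) (p \<circ> ?h)"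
    by (rule homotopic_paths_continuous_image) (use p in \<open>auto simp: path_def path_image_def\<close>)
  moreover have "homotopic_paths S (p \<circ> ?h) (path_restrict p' a b)"
  proof (rule homotopic_paths_eq)
    show "path (p \<circ> ?h)"
      using h p by (intro path_continuous_image) (auto simp: path_def intro: continuous_on_subset)
    show "path_image (p \<circ> ?h) \<subseteq> S"
      using h p by (auto simp: path_image_compose) (auto simp: path_image_def)
    show "(p \<circ> ?h) t = path_restrict p' a b t" if "t \<in> {0..1}" for t
    proof -
      have "a + (b - a) * t \<in> {0..1}"
        using that ab mult_left_le[of t "b - a"] by auto
      then show ?thesis using p' by (simp add: path_restrict_def)
    qed
  qed
  moreover have "p \<circ> ?k = path_restrict p (g a) (g b)"
    by (simp add: path_restrict_def o_def)
  ultimately show ?thesis using homotopic_paths_trans by metis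
qed

lemma gap_class_reparametrize:
  assumes p: "based_path S x p" and q: "based_path S x q"
    and g: "continuous_on {0..1} g" "g ` {0..1} \<subseteq> {0..1}" "g 0 = 0"
    and ab: "0 \<le> a" "a \<le> b" "b \<le> 1"
    and eq: "p (g a) = q (g a)" "p (g b) = q (g b)"
    and p': "\<And>t. t \<in> {0..1} \<Longrightarrow> p' t = p (g t)"
    and q': "\<And>t. t \<in> {0..1} \<Longrightarrow> q' t = q (g t)"
  shows "gap_class S p' q' a b = gap_class S p q (g a) (g b)"
proof -
  have S: "path p" "path_image p \<subseteq> S" "path q" "path_image q \<subseteq> S"
    using p q by (auto simp: based_path_def)
  have "homotopic_paths S (path_restrict p 0 (g b)) (path_restrict p' 0 b)"
    "homotopic_paths S (path_restrict p 0 (g a)) (path_restrict p' 0 a)"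
    "homotopic_paths S (path_restrict q (g a) (g b)) (path_restrict q' a b)"
    using homotopic_path_restrict_reparametrize[OF S(1,2) g(1,2) _ _ _ p', of 0 b]
      homotopic_path_restrict_reparametrize[OF S(1,2) g(1,2) _ _ _ p', of 0 a]
      homotopic_path_restrict_reparametrize[OF S(3,4) g(1,2) _ _ _ q', of a b] ab g(3)
    by simp_all
  then have "homotopic_paths S
      ((path_restrict p 0 (g b) +++ reversepath (path_restrict q (g a) (g b)))
        +++ reversepath (path_restrict p 0 (g a)))
      ((path_restrict p' 0 b +++ reversepath (path_restrict q' a b))
        +++ reversepath (path_restrict p' 0 a))"
    using eq
    by (intro homotopic_paths_join homotopic_paths_reversepath_D)
       (simp_all add: path_restrict_def pathstart_def pathfinish_def joinpaths_def reversepath_def)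
  then show ?thesis
    unfolding gap_class_def by (rule path_class_eqI[symmetric])
qed

lemma path_class_join_reparametrize:
  assumes p: "based_path S x p" and q: "based_path S x q" and eq: "p 1 = q 1"
    and g: "continuous_on {0..1} g" "g ` {0..1} \<subseteq> {0..1}" "g 0 = 0" "g 1 = 1"
    and p': "\<And>t. t \<in> {0..1} \<Longrightarrow> p' t = p (g t)"
    and q': "\<And>t. t \<in> {0..1} \<Longrightarrow> q' t = q (g t)"
  shows "path_class S (p' +++ reversepath q') = path_class S (p +++ reversepath q)"
proof -
  have S: "path p" "path_image p \<subseteq> S" "path q" "path_image q \<subseteq> S"
    using p q by (auto simp: based_path_def)
  have unit: "path_restrict u 0 1 = u" for u :: "real \<Rightarrow> 'a"
    by (simp add: path_restrict_def)
  have "homotopic_paths S p p'" "homotopic_paths S q q'"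
    using homotopic_path_restrict_reparametrize[OF S(1,2) g(1,2) _ _ _ p', of 0 1]
      homotopic_path_restrict_reparametrize[OF S(3,4) g(1,2) _ _ _ q', of 0 1] g(3,4)
    by (simp_all add: unit)
  then have "homotopic_paths S (p +++ reversepath q) (p' +++ reversepath q')"
    using eq by (intro homotopic_paths_join homotopic_paths_reversepath_D)
      (simp_all add: pathfinish_def)
  then show ?thesis by (rule path_class_eqI[symmetric])
qed

text \<open>A Cantor gap that is collapsed to a single point imposes no condition on a subgroup.\<close>

lemma gap_class_degenerate:
  assumes p: "based_path S x p" and q: "based_path S x q" and c: "c \<in> {0..1}" "p c = q c"
  shows "gap_class S p q c c = \<one>\<^bsub>fundamental_group S x\<^esub>"
proof -
  let ?u = "path_restrict p 0 c"
  note u = path_restrict_path[OF p, of 0 c]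
  have x: "p 0 = x" using p by (simp add: based_path_def pathstart_def)
  let ?k = "reversepath (path_restrict q c c)"
  have k: "?k = (\<lambda>_. p c)"
    using c by (simp add: path_restrict_def reversepath_def)
  have "homotopic_paths S (reversepath (?u +++ ?k)) (reversepath ?u)"
  proof -
    have "reversepath (?u +++ ?k) = (\<lambda>_. p c) +++ reversepath ?u"
      using u c by (simp add: k reversepath_joinpaths pathstart_def) (simp add: reversepath_def)
    then show ?thesis using u c by (simp add: homotopic_const_join)
  qed
  then have "homotopic_paths S (?u +++ ?k) ?u"
    by (simp only: homotopic_paths_reversepath)
  moreover have "homotopic_paths S (reversepath ?u) (reversepath ?u)" using u c by simp
  ultimately have "homotopic_paths S ((?u +++ ?k) +++ reversepath ?u) (?u +++ reversepath ?u)"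
    by (rule homotopic_paths_join) (use c in \<open>simp add: k pathfinish_def path_restrict_def
        reversepath_def pathstart_def joinpaths_def\<close>)
  also have "homotopic_paths S (?u +++ reversepath ?u) (\<lambda>_. x)"
    using u c x by (intro homotopic_join_reversepath) auto
  finally show ?thesis
    unfolding gap_class_def by (simp add: path_class_eqI fundamental_group_def)
qed

section \<open>Self-similarity of the Cantor set\<close>

lemma cantor_stage_subset: "cantor_stage n \<subseteq> {0..1}"
  by (induction n) auto

lemma cantor_stage_Suc_left: "x \<le> 1 \<Longrightarrow> x / 3 \<in> cantor_stage (Suc n) \<longleftrightarrow> x \<in> cantor_stage n"
  using cantor_stage_subset[of n] by (auto simp: image_iff field_simps)

lemma cantor_stage_Suc_right:
  "0 \<le> x \<Longrightarrow> (x + 2) / 3 \<in> cantor_stage (Suc n) \<longleftrightarrow> x \<in> cantor_stage n"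
  using cantor_stage_subset[of n] by (auto simp: image_iff field_simps)

lemma cantor_set_iff_Suc: "x \<in> cantor_set \<longleftrightarrow> (\<forall>n. x \<in> cantor_stage (Suc n))"
proof -
  have "x \<in> cantor_stage n" if "\<forall>n. x \<in> cantor_stage (Suc n)" for n
    using that that[rule_format, of 0] cantor_stage_subset[of "Suc 0"] by (cases n) auto
  then show ?thesis unfolding cantor_set_def by blast
qed

lemma cantor_set_left: "x \<le> 1 \<Longrightarrow> x / 3 \<in> cantor_set \<longleftrightarrow> x \<in> cantor_set"
  unfolding cantor_set_iff_Suc[of "x / 3"] by (simp only: cantor_stage_Suc_left)
    (auto simp: cantor_set_def)

lemma cantor_set_right: "0 \<le> x \<Longrightarrow> (x + 2) / 3 \<in> cantor_set \<longleftrightarrow> x \<in> cantor_set"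
  unfolding cantor_set_iff_Suc[of "(x + 2) / 3"] by (simp only: cantor_stage_Suc_right)
    (auto simp: cantor_set_def)

lemma middle_third_endpoints: "1 / 3 \<in> cantor_set" "2 / 3 \<in> cantor_set"
  using cantor_set_left[of 1] cantor_set_right[of 0] cantor_set_endpoints by auto

lemma middle_third_disjoint: "x \<in> cantor_set \<Longrightarrow> x \<le> 1 / 3 \<or> 2 / 3 \<le> x"
  unfolding cantor_set_iff_Suc by (auto dest!: spec[of _ 0])

section \<open>Mapping the Cantor set into a closed set\<close>

text \<open>
  The data of the bisection: around a cut point \<open>m\<close> the interval \<open>{lo m<..<hi m}\<close> is removed, which
  is empty if \<open>m \<in> A\<close> and the component around \<open>m\<close> otherwise.
\<close>

locale bisection =
  fixes A :: "real set" and lo hi :: "real \<Rightarrow> real"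
  assumes closed_A: "closed A" and A_subset: "A \<subseteq> {0..1}"
    and cut_in: "m \<in> {0..1} \<Longrightarrow> lo m \<in> A" "m \<in> {0..1} \<Longrightarrow> hi m \<in> A"
    and cut_gap: "m \<in> {0..1} \<Longrightarrow> lo m = m \<and> hi m = m \<or>
      m \<in> {lo m<..<hi m} \<and> {lo m<..<hi m} \<in> components ({0..1} - A)"
begin

definition lo_mid :: "real \<Rightarrow> real \<Rightarrow> real" where "lo_mid l r = lo ((l + r) / 2)"
definition hi_mid :: "real \<Rightarrow> real \<Rightarrow> real" where "hi_mid l r = hi ((l + r) / 2)"

lemma mid:
  assumes "l \<in> A" "r \<in> A" "l \<le> r"
  shows "lo_mid l r \<in> A" "hi_mid l r \<in> A"
    "l \<le> lo_mid l r" "lo_mid l r \<le> hi_mid l r" "hi_mid l r \<le> r"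
    "lo_mid l r - l \<le> (r - l) / 2" "r - hi_mid l r \<le> (r - l) / 2"
    "lo_mid l r = hi_mid l r \<or> {lo_mid l r<..<hi_mid l r} \<in> components ({0..1} - A)"
proof -
  let ?m = "(l + r) / 2"
  have m: "?m \<in> {0..1}" using assms A_subset by auto
  note cut = cut_in[OF m] cut_gap[OF m]
  then show "lo_mid l r \<in> A" "hi_mid l r \<in> A" "lo_mid l r \<le> hi_mid l r"
    "lo_mid l r = hi_mid l r \<or> {lo_mid l r<..<hi_mid l r} \<in> components ({0..1} - A)"
    by (auto simp: lo_mid_def hi_mid_def)
  have "s \<notin> A" if s: "s \<in> {lo ?m<..<hi ?m}" for s
  proof -
    have "{lo ?m<..<hi ?m} \<in> components ({0..1} - A)" using s cut(3) by auto
    then show ?thesis using s in_components_subset by blast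
  qed
  then have "l \<notin> {lo ?m<..<hi ?m}" "r \<notin> {lo ?m<..<hi ?m}" using assms by auto
  then show "l \<le> lo_mid l r" "hi_mid l r \<le> r"
    using cut assms(3) by (auto simp: lo_mid_def hi_mid_def)
  show "lo_mid l r - l \<le> (r - l) / 2" "r - hi_mid l r \<le> (r - l) / 2"
    using cut by (auto simp: lo_mid_def hi_mid_def field_simps)
qed

text \<open>
  Finite approximations: \<open>n\<close> bisections of \<open>{l..r}\<close>, each cut-out piece being traversed over the
  middle third and the rest in a straight line. The interval is a parameter of the recursion since
  the outer thirds repeat the construction on the two smaller intervals.
\<close>

primrec approx :: "nat \<Rightarrow> real \<Rightarrow> real \<Rightarrow> real \<Rightarrow> real" where
  "approx 0 l r t = l + (r - l) * t"
| "approx (Suc n) l r t =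
     (if t \<le> 1 / 3 then approx n l (lo_mid l r) (3 * t)
      else if t \<le> 2 / 3 then lo_mid l r + (hi_mid l r - lo_mid l r) * (3 * t - 1)
      else approx n (hi_mid l r) r (3 * t - 2))"

lemma approx_endpoints: "approx n l r 0 = l" "approx n l r 1 = r"
  by (induction n arbitrary: l r) auto

lemma continuous_on_approx: "continuous_on {0..1} (approx n l r)"
proof (induction n arbitrary: l r)
  case 0
  then show ?case by (simp add: continuous_intros)
next
  case (Suc n)
  have left: "continuous_on {t \<in> {0..1}. t \<le> 1 / 3} (\<lambda>t. approx n l (lo_mid l r) (3 * t))"
    by (rule continuous_on_compose2[OF Suc]) (auto intro!: continuous_intros)
  have right: "continuous_on {t \<in> {t \<in> {0..1}. 1 / 3 \<le> t}. 2 / 3 \<le> t}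
      (\<lambda>t. approx n (hi_mid l r) r (3 * t - 2))"
    by (rule continuous_on_compose2[OF Suc]) (auto intro!: continuous_intros)
  show ?case
    unfolding approx.simps
    by (intro continuous_on_cases_le left right)
       (auto intro!: continuous_intros simp: approx_endpoints mult.commute[of 3])
qed

lemma approx_in_interval:
  assumes "l \<in> A" "r \<in> A" "l \<le> r" "t \<in> {0..1}"
  shows "approx n l r t \<in> {l..r}"
  using assms
proof (induction n arbitrary: l r t)
  case 0
  then show ?case using mult_left_le[of t "r - l"] by auto
next
  case (Suc n)
  note mid = mid[OF Suc.prems(1-3)]
  consider "t \<le> 1 / 3" | "1 / 3 < t" "t \<le> 2 / 3" | "2 / 3 < t" by linarith
  then show ?case
  proof cases
    case 1
    then show ?thesis using Suc.IH[of l "lo_mid l r" "3 * t"] Suc.prems mid by auto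
  next
    case 2
    then have "(hi_mid l r - lo_mid l r) * (3 * t - 1) \<in> {0..hi_mid l r - lo_mid l r}"
      using mid(4) by (auto intro!: mult_left_le mult_nonneg_nonneg)
    then show ?thesis using 2 mid(3,5) by simp
  next
    case 3
    then show ?thesis using Suc.IH[of "hi_mid l r" r "3 * t - 2"] Suc.prems mid by auto
  qed
qed

lemma halved_bound: "u \<le> w / 2 \<Longrightarrow> x \<le> u / 2 ^ n \<Longrightarrow> x \<le> w / 2 ^ Suc n" for u w x :: real
  using divide_right_mono[of u "w / 2" "2 ^ n"] by simp

lemma approx_Cauchy_bound:
  assumes "l \<in> A" "r \<in> A" "l \<le> r" "t \<in> {0..1}"
  shows "\<bar>approx (n + k) l r t - approx n l r t\<bar> \<le> (r - l) / 2 ^ n"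
  using assms
proof (induction n arbitrary: l r t)
  case 0
  then show ?case
    using approx_in_interval[OF 0, of k] approx_in_interval[OF 0, of 0]
    by (simp only: atLeastAtMost_iff add_0 power_0 div_by_1) linarith
next
  case (Suc n)
  note mid = mid[OF Suc.prems(1-3)]
  consider "t \<le> 1 / 3" | "1 / 3 < t" "t \<le> 2 / 3" | "2 / 3 < t" by linarith
  then show ?case
  proof cases
    case 1
    then have "\<bar>approx (Suc n + k) l r t - approx (Suc n) l r t\<bar> \<le> (lo_mid l r - l) / 2 ^ n"
      using Suc.IH[of l "lo_mid l r" "3 * t"] Suc.prems mid by simp
    then show ?thesis by (rule halved_bound[OF mid(6)])
  next
    case 2
    then show ?thesis using Suc.prems by simp
  next
    case 3
    then have "\<bar>approx (Suc n + k) l r t - approx (Suc n) l r t\<bar> \<le> (r - hi_mid l r) / 2 ^ n"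
      using Suc.IH[of "hi_mid l r" r "3 * t - 2"] Suc.prems mid by simp
    then show ?thesis by (rule halved_bound[OF mid(7)])
  qed
qed

definition limit_map :: "real \<Rightarrow> real \<Rightarrow> real \<Rightarrow> real" where
  "limit_map l r t = lim (\<lambda>n. approx n l r t)"

lemma uniform_limit_approx:
  assumes lr: "l \<in> A" "r \<in> A" "l \<le> r"
  shows "uniform_limit {0..1} (\<lambda>n. approx n l r) (limit_map l r) sequentially"
proof -
  have "uniformly_Cauchy_on {0..1} (\<lambda>n. approx n l r)"
  proof (rule uniformly_Cauchy_onI')
    fix e :: real assume e: "0 < e"
    have "(\<lambda>n. (r - l) / 2 ^ n) \<longlonglongrightarrow> 0" by (rule LIMSEQ_divide_realpow_zero) simp
    then have "\<forall>\<^sub>F n in sequentially. (r - l) / 2 ^ n < e"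
      using e by (rule order_tendstoD)
    then obtain M where M: "(r - l) / 2 ^ m < e" if "M \<le> m" for m
      by (auto simp: eventually_sequentially)
    have "dist (approx m l r t) (approx n l r t) < e" if "t \<in> {0..1}" "M \<le> m" "m < n" for t m n
      using approx_Cauchy_bound[OF lr that(1), of m "n - m"] M[OF that(2)] that(3)
      by (simp add: dist_real_def abs_minus_commute)
    then show "\<exists>M. \<forall>t\<in>{0..1}. \<forall>m\<ge>M. \<forall>n>m. dist (approx m l r t) (approx n l r t) < e" by blast
  qed
  then have "uniformly_convergent_on {0..1} (\<lambda>n. approx n l r)"
    by (rule Cauchy_uniformly_convergent)
  then show ?thesis
    unfolding uniformly_convergent_uniform_limit_iff limit_map_def .
qed

lemma approx_tendsto:
  assumes "l \<in> A" "r \<in> A" "l \<le> r" "t \<in> {0..1}"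
  shows "(\<lambda>n. approx n l r t) \<longlonglongrightarrow> limit_map l r t"
  using tendsto_uniform_limitI[OF uniform_limit_approx[OF assms(1-3)] assms(4)] .

lemma limit_map_endpoints: "limit_map l r 0 = l" "limit_map l r 1 = r"
  by (simp_all add: limit_map_def approx_endpoints)

lemma continuous_on_limit_map:
  assumes "l \<in> A" "r \<in> A" "l \<le> r"
  shows "continuous_on {0..1} (limit_map l r)"
  by (rule uniform_limit_theorem[OF _ uniform_limit_approx[OF assms]])
     (simp_all add: continuous_on_approx)

lemma limit_map_in_interval:
  assumes "l \<in> A" "r \<in> A" "l \<le> r" "t \<in> {0..1}"
  shows "limit_map l r t \<in> {l..r}"
  by (rule closed_sequentially[OF _ _ approx_tendsto[OF assms]])
     (use approx_in_interval[OF assms] in auto)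

lemma limit_map_left:
  assumes lr: "l \<in> A" "r \<in> A" "l \<le> r" and t: "t \<in> {0..1}"
  shows "limit_map l r (t / 3) = limit_map l (lo_mid l r) t"
proof (rule LIMSEQ_unique)
  show "(\<lambda>n. approx (Suc n) l r (t / 3)) \<longlonglongrightarrow> limit_map l r (t / 3)"
    using t by (intro LIMSEQ_Suc approx_tendsto lr) auto
  have "approx (Suc n) l r (t / 3) = approx n l (lo_mid l r) t" for n
    using t by simp
  then show "(\<lambda>n. approx (Suc n) l r (t / 3)) \<longlonglongrightarrow> limit_map l (lo_mid l r) t"
    using approx_tendsto[OF lr(1) mid(1)[OF lr] mid(3)[OF lr] t] by simp
qed

lemma limit_map_right:
  assumes lr: "l \<in> A" "r \<in> A" "l \<le> r" and t: "t \<in> {0..1}"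
  shows "limit_map l r ((t + 2) / 3) = limit_map (hi_mid l r) r t"
proof (rule LIMSEQ_unique)
  show "(\<lambda>n. approx (Suc n) l r ((t + 2) / 3)) \<longlonglongrightarrow> limit_map l r ((t + 2) / 3)"
    using t by (intro LIMSEQ_Suc approx_tendsto lr) auto
  have "approx (Suc n) l r ((t + 2) / 3) = approx n (hi_mid l r) r t" for n
  proof (cases "t = 0")
    case True
    then show ?thesis by (simp add: approx_endpoints)
  next
    case False
    have "3 * ((t + 2) / 3) - 2 = t" by (simp add: add_divide_distrib)
    then show ?thesis using t False by (simp del: times_divide_eq_right)
  qed
  then show "(\<lambda>n. approx (Suc n) l r ((t + 2) / 3)) \<longlonglongrightarrow> limit_map (hi_mid l r) r t"
    using approx_tendsto[OF mid(2)[OF lr] lr(2) mid(5)[OF lr] t] by simp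
qed

text \<open>
  The thirds removed in the first \<open>n\<close> steps account for the pieces cut out by the first \<open>n\<close>
  bisections, so a point of stage \<open>n\<close> goes into one of the remaining intervals, whose endpoints
  are in \<open>A\<close> and whose length is at most \<open>(r - l) / 2 ^ n\<close>.
\<close>

lemma limit_map_near:
  assumes "l \<in> A" "r \<in> A" "l \<le> r" "t \<in> cantor_stage n"
  shows "\<exists>a\<in>A. \<bar>limit_map l r t - a\<bar> \<le> (r - l) / 2 ^ n"
  using assms
proof (induction n arbitrary: l r t)
  case 0
  then show ?case using limit_map_in_interval[of l r t] by (intro bexI[of _ l]) auto
next
  case (Suc n)
  note mid = mid[OF Suc.prems(1-3)]
  from Suc.prems(4) consider
      s where "s \<in> cantor_stage n" "t = s / 3" | s where "s \<in> cantor_stage n" "t = (s + 2) / 3"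
    by auto
  then show ?case
  proof cases
    case 1
    then have "limit_map l r t = limit_map l (lo_mid l r) s"
      using limit_map_left[OF Suc.prems(1-3)] cantor_stage_subset by blast
    then show ?thesis
      using Suc.IH[OF Suc.prems(1) mid(1,3) 1(1)] halved_bound[OF mid(6)] by metis
  next
    case 2
    then have "limit_map l r t = limit_map (hi_mid l r) r s"
      using limit_map_right[OF Suc.prems(1-3)] cantor_stage_subset by blast
    then show ?thesis
      using Suc.IH[OF mid(2) Suc.prems(2) mid(5) 2(1)] halved_bound[OF mid(7)] by metis
  qed
qed

lemma limit_map_cantor_set:
  assumes lr: "l \<in> A" "r \<in> A" "l \<le> r" and t: "t \<in> cantor_set"
  shows "limit_map l r t \<in> A"
proof -
  have "\<exists>a\<in>A. \<bar>limit_map l r t - a\<bar> \<le> (r - l) / 2 ^ n" for n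
    using t by (intro limit_map_near lr) (auto simp: cantor_set_def)
  then obtain a where a: "a n \<in> A" "\<bar>limit_map l r t - a n\<bar> \<le> (r - l) / 2 ^ n" for n by metis
  have "(\<lambda>n. (r - l) / 2 ^ n) \<longlonglongrightarrow> 0" by (rule LIMSEQ_divide_realpow_zero) simp
  then have "(\<lambda>n. limit_map l r t - a n) \<longlonglongrightarrow> 0"
    by (rule Lim_null_comparison[rotated]) (simp add: a)
  then have "(\<lambda>n. limit_map l r t - (limit_map l r t - a n)) \<longlonglongrightarrow> limit_map l r t - 0"
    by (intro tendsto_diff tendsto_const)
  then show ?thesis
    using closed_sequentially[OF closed_A, of a] a(1) by simp
qed

text \<open>
  A gap containing a point outside stage \<open>n\<close> was removed in one of the first \<open>n\<close> steps. It is
  the middle third, whose endpoints go to the two sides of the cut, or a scaled copy, in one of the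
  outer thirds, of a gap removed earlier, where \<open>limit_map\<close> repeats itself on a smaller
  interval.
\<close>

lemma limit_map_gap:
  assumes "l \<in> A" "r \<in> A" "l \<le> r"
    and "a \<in> cantor_set" "b \<in> cantor_set" "{a<..<b} \<inter> cantor_set = {}"
    and "t \<in> {a<..<b}" "t \<notin> cantor_stage n"
  shows "limit_map l r a = limit_map l r b \<or>
    {limit_map l r a<..<limit_map l r b} \<in> components ({0..1} - A)"
  using assms
proof (induction n arbitrary: l r a b t)
  case 0
  then show ?case using cantor_set_subset by force
next
  case (Suc n)
  note lr = Suc.prems(1-3) and ab = Suc.prems(4-6) and t = Suc.prems(7,8)
  note mid = mid[OF lr]
  have unit: "a \<in> {0..1}" "b \<in> {0..1}" using ab cantor_set_subset by auto
  have third: "1 / 3 \<notin> {a<..<b}" "2 / 3 \<notin> {a<..<b}"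
    using ab(3) middle_third_endpoints by blast+
  have third_t: "t \<noteq> 1 / 3" "t \<noteq> 2 / 3" using third t by auto
  then consider "t < 1 / 3" | "1 / 3 < t" "t < 2 / 3" | "2 / 3 < t" by linarith
  then show ?case
  proof cases
    case 1
    then have b: "b \<le> 1 / 3" using third t by auto
    have "{3 * a<..<3 * b} \<inter> cantor_set = {}"
    proof -
      have "s / 3 \<in> {a<..<b} \<inter> cantor_set" if "s \<in> {3 * a<..<3 * b} \<inter> cantor_set" for s
        using that b cantor_set_left[of s] by auto
      then show ?thesis using ab(3) by blast
    qed
    moreover have "3 * a \<in> cantor_set" "3 * b \<in> cantor_set"
      using ab(1,2) b t cantor_set_left[of "3 * a"] cantor_set_left[of "3 * b"] by auto
    moreover have "3 * t \<notin> cantor_stage n"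
      using 1 t(2) cantor_stage_Suc_left[of "3 * t" n] by simp
    ultimately show ?thesis
      using Suc.IH[OF lr(1) mid(1,3), of "3 * a" "3 * b" "3 * t"] t(1) unit b
        limit_map_left[OF lr, of "3 * a"] limit_map_left[OF lr, of "3 * b"] by simp
  next
    case 2
    then have "a = 1 / 3" "b = 2 / 3"
      using third t(1) middle_third_disjoint[OF ab(1)] middle_third_disjoint[OF ab(2)] by auto
    moreover have "limit_map l r (1 / 3) = lo_mid l r" "limit_map l r (2 / 3) = hi_mid l r"
      using limit_map_left[OF lr, of 1] limit_map_right[OF lr, of 0]
      by (simp_all add: limit_map_endpoints)
    ultimately show ?thesis using mid(8) by (simp only:)
  next
    case 3
    then have a: "2 / 3 \<le> a" using third t by auto
    have "{3 * a - 2<..<3 * b - 2} \<inter> cantor_set = {}"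
    proof -
      have "(s + 2) / 3 \<in> {a<..<b} \<inter> cantor_set"
        if "s \<in> {3 * a - 2<..<3 * b - 2} \<inter> cantor_set" for s
        using that a cantor_set_right[of s] by auto
      then show ?thesis using ab(3) by blast
    qed
    moreover have "3 * a - 2 \<in> cantor_set" "3 * b - 2 \<in> cantor_set"
      using ab(1,2) a t cantor_set_right[of "3 * a - 2"] cantor_set_right[of "3 * b - 2"] by auto
    moreover have "3 * t - 2 \<notin> cantor_stage n"
      using 3 t(2) cantor_stage_Suc_right[of "3 * t - 2" n] by simp
    ultimately show ?thesis
      using Suc.IH[OF mid(2) lr(2) mid(5), of "3 * a - 2" "3 * b - 2" "3 * t - 2"] t(1) unit a
        limit_map_right[OF lr, of "3 * a - 2"] limit_map_right[OF lr, of "3 * b - 2"] by simp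
  qed
qed

end

text \<open>
  The two extreme cases: for \<open>A = {0..1}\<close> every gap is collapsed and \<open>g\<close> is the Cantor function;
  for \<open>A = {0, 1}\<close> the middle third is stretched over the whole interval and all other gaps are
  collapsed to \<open>0\<close> or \<open>1\<close>.
\<close>

lemma cantor_parametrization:
  fixes A :: "real set"
  assumes A: "closed A" "A \<subseteq> {0..1}" "{0, 1} \<subseteq> A"
  obtains g :: "real \<Rightarrow> real" where
    "continuous_on {0..1} g" "g ` {0..1} \<subseteq> {0..1}" "g 0 = 0" "g 1 = 1" "g ` cantor_set \<subseteq> A"
    "\<And>a b. cantor_gap a b \<Longrightarrow> g a = g b \<or> {g a<..<g b} \<in> components ({0..1} - A)"
proof -
  have "\<exists>c d. c \<in> A \<and> d \<in> A \<and>
      (c = m \<and> d = m \<or> m \<in> {c<..<d} \<and> {c<..<d} \<in> components ({0..1} - A))" if m: "m \<in> {0..1}" for m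
  proof (cases "m \<in> A")
    case False
    then have "m \<in> {0..1} - A" using m by simp
    then obtain c d where "{c<..<d} \<in> components ({0..1} - A)" "m \<in> {c<..<d}" "c \<in> A" "d \<in> A"
      by (rule complement_component_exists[OF A])
    then show ?thesis by (intro exI[of _ c] exI[of _ d]) auto
  qed (use m in auto)
  then obtain lo hi where "bisection A lo hi"
    unfolding bisection_def using A by metis
  then interpret bisection A lo hi .
  have ends: "(0::real) \<in> A" "(1::real) \<in> A" "(0::real) \<le> 1" using A(3) by auto
  show thesis
  proof
    show "limit_map 0 1 a = limit_map 0 1 b \<or>
        {limit_map 0 1 a<..<limit_map 0 1 b} \<in> components ({0..1} - A)" if "cantor_gap a b" for a b
    proof -
      note D = cantor_gapD[OF that]
      have t: "(a + b) / 2 \<in> {a<..<b}" using D(1) by auto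
      then obtain n where "(a + b) / 2 \<notin> cantor_stage n"
        using D(6) unfolding cantor_set_def by blast
      then show ?thesis using D(2,3,6) t by (intro limit_map_gap[OF ends]) auto
    qed
  qed (use continuous_on_limit_map[OF ends] limit_map_in_interval[OF ends]
      limit_map_cantor_set[OF ends] in \<open>auto simp: limit_map_endpoints\<close>)
qed

section \<open>Maps on the test space from pairs of paths\<close>

lemma W_space_eq: "W_space = path_image lower_path \<union> path_image upper_path"
proof
  show "path_image lower_path \<union> path_image upper_path \<subseteq> W_space"
    using path_image_upper_path based_path_lower_path by (auto simp: based_path_def)
  show "W_space \<subseteq> path_image lower_path \<union> path_image upper_path"
  proof
    fix z assume "z \<in> W_space"
    then consider "z \<in> {0..1} \<times> {0}" | a b where "cantor_gap a b" "z \<in> half_circle a b"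
      unfolding W_space_def by blast
    then show "z \<in> path_image lower_path \<union> path_image upper_path"
    proof cases
      case 1
      then show ?thesis by (auto simp: path_image_def lower_path_def)
    next
      case (2 a b)
      note D = cantor_gapD[OF 2(1)]
      have "(fst z, snd z) \<in> half_circle a b" using 2(2) by simp
      then have "fst z \<in> {a..b}" "snd z = sqrt ((fst z - a) * (b - fst z))"
        unfolding half_circle_iff[OF D(1)] by auto
      then have "z = upper_path (fst z)" "fst z \<in> {0..1}"
        using upper_path_gap[OF 2(1), of "fst z"] D by (auto simp: prod_eq_iff)
      then show ?thesis unfolding path_image_def by blast
    qed
  qed
qed

lemma fst_upper_path: "fst (upper_path t) = t"
  by (simp add: upper_path_def)

lemma upper_path_on_axis:
  assumes "t \<in> {0..1}" "snd (upper_path t) = 0"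
  shows "t \<in> cantor_set"
  using assms(1)
proof (cases rule: unit_interval_cases)
  case (2 a b)
  then show ?thesis using assms(2) upper_path_gap[OF 2(1), of t] by auto
qed

text \<open>
  The two arcs are closed and meet exactly over the Cantor set, so a pair of paths that agree there
  glues to a continuous map.
\<close>

lemma map_from_path_pair:
  assumes p: "based_path S x p" and q: "based_path S x q"
    and eq: "\<And>t. t \<in> cantor_set \<Longrightarrow> p t = q t"
  obtains f where "continuous_on W_space f" "f ` W_space \<subseteq> S" "f (0, 0) = x"
    "\<forall>t\<in>{0..1}. f (upper_path t) = p t" "\<forall>t\<in>{0..1}. f (lower_path t) = q t"
proof -
  define f where "f z = (if snd z = 0 then q (fst z) else p (fst z))" for z :: "real \<times> real"
  have upper: "f (upper_path t) = p t" if "t \<in> {0..1}" for t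
    using that upper_path_on_axis[OF that] eq by (auto simp: f_def fst_upper_path)
  have lower: "f (lower_path t) = q t" for t
    by (simp add: f_def lower_path_def)
  have cont: "continuous_on {0..1} p" "continuous_on {0..1} q"
    using p q by (auto simp: based_path_def path_def)
  have path_lower: "path lower_path" using based_path_lower_path by (simp add: based_path_def)
  have "continuous_on (path_image lower_path \<union> path_image upper_path) f"
    unfolding f_def
  proof (rule continuous_on_cases)
    show "closed (path_image lower_path)" "closed (path_image upper_path)"
      using path_lower path_upper_path by (auto intro: closed_path_image)
    show "continuous_on (path_image lower_path) (\<lambda>z. q (fst z))"
      by (rule continuous_on_compose2[OF cont(2)])
         (auto intro!: continuous_intros simp: path_image_def lower_path_def)
    show "continuous_on (path_image upper_path) (\<lambda>z. p (fst z))"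
      by (rule continuous_on_compose2[OF cont(1)])
         (auto intro!: continuous_intros simp: path_image_def fst_upper_path)
    show "\<forall>z. z \<in> path_image lower_path \<and> snd z \<noteq> 0 \<or> z \<in> path_image upper_path \<and> snd z = 0 \<longrightarrow>
        q (fst z) = p (fst z)"
    proof (intro allI impI)
      fix z
      assume "z \<in> path_image lower_path \<and> snd z \<noteq> 0 \<or> z \<in> path_image upper_path \<and> snd z = 0"
      then obtain t where "t \<in> {0..1}" "z = upper_path t" "snd (upper_path t) = 0"
        by (auto simp: path_image_def lower_path_def)
      then show "q (fst z) = p (fst z)"
        using upper_path_on_axis eq by (simp add: fst_upper_path)
    qed
  qed
  then have "continuous_on W_space f" by (simp add: W_space_eq)
  moreover have "f ` W_space \<subseteq> S"
    using p q upper lower by (auto simp: W_space_eq path_image_def based_path_def)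
  moreover have "f (0, 0) = x"
    using q by (simp add: f_def based_path_def pathstart_def)
  ultimately show thesis using that upper lower by blast
qed

section \<open>The equivalence\<close>

lemma closed_subgroup_if_transfinite_path_products:
  assumes H: "transfinite_path_products X x H"
  shows "closed_subgroup W_space (0, 0) W_subgroup w_infinity X x H"
  unfolding closed_subgroup_def
proof (intro allI impI, elim conjE)
  fix f
  assume f: "continuous_on W_space f" "f ` W_space \<subseteq> X" "f (0, 0) = x"
    and W: "induced_map X f ` W_subgroup \<subseteq> H"
  let ?p = "f \<circ> upper_path" and ?q = "f \<circ> lower_path"
  have based: "based_path X x (f \<circ> u)" if "based_path W_space (0, 0) u" for u
    using that f unfolding based_path_def
    by (auto simp: path_image_compose pathstart_compose
        intro!: path_continuous_image intro: continuous_on_subset)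
  have "gap_class X ?p ?q a b \<in> H" if ab: "cantor_gap a b" for a b
  proof -
    have "gap_class W_space upper_path lower_path a b \<in> W_subgroup"
      unfolding W_subgroup_def using ab by (intro generate.incl) blast
    moreover have "induced_map X f (gap_class W_space upper_path lower_path a b) =
        gap_class X ?p ?q a b"
      using cantor_gapD[OF ab]
      by (intro induced_map_gap_class[OF f(1,2) based_path_upper_path based_path_lower_path])
         (auto simp: upper_path_cantor lower_path_def)
    ultimately show ?thesis using W by force
  qed
  moreover have "?p t = ?q t" if "t \<in> cantor_set" for t
    using that by (simp add: upper_path_cantor lower_path_def)
  ultimately have "path_class X (?p +++ reversepath ?q) \<in> H"
    using H[unfolded transfinite_path_products_def, rule_format, of cantor_set ?p ?q] cantor_facts
      based[OF based_path_upper_path] based[OF based_path_lower_path]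
    by (auto simp: cantor_gap_def)
  then show "induced_map X f w_infinity \<in> H"
    by (simp add: induced_map_w_infinity[OF f(1,2)])
qed

lemma transfinite_path_products_if_closed_subgroup:
  assumes H: "subgroup H (fundamental_group X x)"
    and closed: "closed_subgroup W_space (0, 0) W_subgroup w_infinity X x H"
  shows "transfinite_path_products X x H"
  unfolding transfinite_path_products_def
proof (intro allI impI, elim conjE)
  fix A p q
  assume A: "closed A" "A \<subseteq> {0..1}" "{0, 1} \<subseteq> A"
    and p: "based_path X x p" and q: "based_path X x q" and eq: "\<forall>t\<in>A. p t = q t"
    and gaps: "\<forall>a b. {a<..<b} \<in> components ({0..1} - A) \<longrightarrow> gap_class X p q a b \<in> H"
  obtain g where g: "continuous_on {0..1} g" "g ` {0..1} \<subseteq> {0..1}" "g 0 = 0" "g 1 = 1"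
      and gA: "g ` cantor_set \<subseteq> A"
      and g_gap: "\<And>a b. cantor_gap a b \<Longrightarrow> g a = g b \<or> {g a<..<g b} \<in> components ({0..1} - A)"
    using cantor_parametrization[OF A] by blast
  have based: "based_path X x (u \<circ> g)" if "based_path X x u" for u
    using that g unfolding based_path_def path_def path_image_def
    by (auto simp: pathstart_def image_subset_iff intro: continuous_on_compose2[of "{0..1}" u])
  have "(p \<circ> g) t = (q \<circ> g) t" if "t \<in> cantor_set" for t
    using that gA eq by auto
  then obtain f where f: "continuous_on W_space f" "f ` W_space \<subseteq> X" "f (0, 0) = x"
      and f_paths: "\<forall>t\<in>{0..1}. f (upper_path t) = (p \<circ> g) t"
        "\<forall>t\<in>{0..1}. f (lower_path t) = (q \<circ> g) t"
    by (rule map_from_path_pair[OF based[OF p] based[OF q]])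
  have upper: "(f \<circ> upper_path) t = p (g t)" and lower: "(f \<circ> lower_path) t = q (g t)"
    if "t \<in> {0..1}" for t
    using f_paths that by simp_all
  let ?W = "{gap_class W_space upper_path lower_path a b | a b. cantor_gap a b}"
  have "gap_class W_space upper_path lower_path a b \<in> carrier (fundamental_group W_space (0, 0)) \<and>
      induced_map X f (gap_class W_space upper_path lower_path a b) \<in> H"
    if ab: "cantor_gap a b" for a b
  proof -
    note D = cantor_gapD[OF ab]
    have W_eq: "upper_path a = lower_path a" "upper_path b = lower_path b"
      using D by (auto simp: upper_path_cantor lower_path_def)
    have g_eq: "p (g a) = q (g a)" "p (g b) = q (g b)" "g a \<in> {0..1}"
      using D(2,3) gA A(2) eq by blast+
    have "induced_map X f (gap_class W_space upper_path lower_path a b) =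
        gap_class X (f \<circ> upper_path) (f \<circ> lower_path) a b"
      using D W_eq
      by (intro induced_map_gap_class[OF f(1,2) based_path_upper_path based_path_lower_path]) auto
    also have "\<dots> = gap_class X p q (g a) (g b)"
      using D by (intro gap_class_reparametrize[OF p q g(1-3) _ _ _ g_eq(1,2) upper lower]) auto
    also have "\<dots> \<in> H"
      using g_gap[OF ab]
    proof
      assume "g a = g b"
      then show ?thesis
        using gap_class_degenerate[OF p q g_eq(3,1)] subgroup.one_closed[OF H] by simp
    qed (use gaps in blast)
    finally have "induced_map X f (gap_class W_space upper_path lower_path a b) \<in> H" .
    then show ?thesis
      using gap_class_in_carrier[OF based_path_upper_path based_path_lower_path, of a b] D W_eq
      by simp
  qed
  then have "?W \<subseteq> carrier (fundamental_group W_space (0, 0))" "induced_map X f ` ?W \<subseteq> H" by auto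
  then have "induced_map X f ` W_subgroup \<subseteq> H"
    unfolding W_subgroup_def
    by (intro induced_map_generate_subset[OF f _ H]) (auto simp: W_space_def)
  then have "induced_map X f w_infinity \<in> H"
    using closed f unfolding closed_subgroup_def by blast
  then have "path_class X ((f \<circ> upper_path) +++ reversepath (f \<circ> lower_path)) \<in> H"
    by (simp add: induced_map_w_infinity[OF f(1,2)])
  moreover have "p 1 = q 1" using eq A(3) by blast
  then have "path_class X ((f \<circ> upper_path) +++ reversepath (f \<circ> lower_path)) =
      path_class X (p +++ reversepath q)"
    by (rule path_class_join_reparametrize[OF p q _ g upper lower])
  ultimately show "path_class X (p +++ reversepath q) \<in> H" by (simp only:)
qed

theorem proposition7p5:
  fixes X :: "'a::topological_space set" and x0 :: 'a and H :: "(real \<Rightarrow> 'a) set set"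
  assumes "path_connected X"
    and "x0 \<in> X"
    and "subgroup H (fundamental_group X x0)"
  shows "transfinite_path_products X x0 H \<longleftrightarrow>
         closed_subgroup W_space (0, 0) W_subgroup w_infinity X x0 H"
  using closed_subgroup_if_transfinite_path_products
    transfinite_path_products_if_closed_subgroup[OF assms(3)] by blast

end
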